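(* For every $\beta\in(0,\frac12)$ there exists a sequence $(X_n)_{n\ge1}$ of centered independent random variables such that: there are constants $C_1,C_2>0$ with $C_1n^{-\beta}\le\|X_n\|_{L^\infty}\le C_2n^{-\beta}$ for all $n$ large enough; with $S_N=\sum_{n=1}^NX_n$, the variance $V(S_N)$ is of order $N^{1-2\beta}$ (i.e. $V(S_N)/N^{1-2\beta}$ is bounded above and bounded away from $0$ for all large $N$); but $S_N$ fails to satisfy the Edgeworth expansion of order $s$ for every integer $s$ with $s>\frac1{1-2\beta}$.
   Context: Let $\sigma_N=\sqrt{V(S_N)}$, where $V$ denotes variance, and $\hat S_N=(S_N-\mathbb E[S_N])/\sigma_N$. $S_N$ satisfies the Edgeworth expansion of order $s$ (integer $s\ge1$) if there are polynomials $P_{1,N},\dots,P_{s,N}$ with degrees not depending on $N$ and coefficients uniformly bounded in $N$ such that $\sup_{t\in\mathbb R}\big|\mathbb P(\hat S_N\le t)-\Phi(t)-\sum_{j=1}^s\sigma_N^{-j}P_{j,N}(t)\phi(t)\big|=o(\sigma_N^{-s})$ as $N\to\infty$, where $\Phi$ and $\phi(t)=\frac1{\sqrt{2\pi}}e^{-t^2/2}$ are the standard normal distribution function and density. *)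

theory Defs
  imports "HOL-Probability.Probability"
begin

text \<open>The value is an extended real: it is \<open>\<infinity>\<close> for functions that are not essentially bounded
  (and for non-measurable ones).\<close>

definition Linf_norm :: "'a measure \<Rightarrow> ('a \<Rightarrow> real) \<Rightarrow> ereal" where
  "Linf_norm M f = esssup M (\<lambda>x. ereal \<bar>f x\<bar>)"

definition partial_sum :: "(nat \<Rightarrow> 'a \<Rightarrow> real) \<Rightarrow> nat \<Rightarrow> 'a \<Rightarrow> real" where
  "partial_sum X N x = (\<Sum>n=1..N. X n x)"

definition std_dev :: "'a measure \<Rightarrow> ('a \<Rightarrow> real) \<Rightarrow> real" where
  "std_dev M Y = sqrt (prob_space.variance M Y)"

definition standardized :: "'a measure \<Rightarrow> ('a \<Rightarrow> real) \<Rightarrow> 'a \<Rightarrow> real" where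
  "standardized M Y x = (Y x - prob_space.expectation M Y) / std_dev M Y"

definition edgeworth_error ::
  "'a measure \<Rightarrow> (nat \<Rightarrow> 'a \<Rightarrow> real) \<Rightarrow> nat \<Rightarrow> (nat \<Rightarrow> nat \<Rightarrow> real poly) \<Rightarrow> nat \<Rightarrow> real \<Rightarrow> real" where
  "edgeworth_error M S s P N t =
     prob_space.prob M {x \<in> space M. standardized M (S N) x \<le> t}
     - cdf std_normal_distribution t
     - (\<Sum>j=1..s. (1 / std_dev M (S N) ^ j) * poly (P j N) t * std_normal_density t)"

text \<open>Intended for \<open>s \<ge> 1\<close>. The degrees are bounded by a \<open>d\<close> that does not depend on \<open>N\<close>;
  leading coefficients are allowed to vanish. The supremum is over a bounded set of reals,
  because polynomials times the normal density are bounded. Values of \<open>N\<close> with zero standard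
  deviation are governed by the convention \<open>x / 0 = 0\<close>; they do not matter if there are only
  finitely many of them.\<close>

definition edgeworth_expansion :: "'a measure \<Rightarrow> (nat \<Rightarrow> 'a \<Rightarrow> real) \<Rightarrow> nat \<Rightarrow> bool" where
  "edgeworth_expansion M S s \<longleftrightarrow>
     (\<exists>(P :: nat \<Rightarrow> nat \<Rightarrow> real poly) (d :: nat) (B :: real).
        (\<forall>j\<in>{1..s}. \<forall>N. degree (P j N) \<le> d) \<and>
        (\<forall>j\<in>{1..s}. \<forall>N k. \<bar>coeff (P j N) k\<bar> \<le> B) \<and>
        (\<lambda>N. SUP t. \<bar>edgeworth_error M S s P N t\<bar>) \<in> o(\<lambda>N. 1 / std_dev M (S N) ^ s))"

end

theory Submission
  imports Defs
begin

text \<open>Take \<open>X\<^sub>n = \<plusminus>2\<^sup>-\<^sup>m\<close> with \<open>m = \<lfloor>\<beta> log\<^sub>2 n\<rfloor>\<close> and fair signs. Then \<open>S\<^sub>N\<close> lives on a lattice of mesh of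
  order \<open>N\<^sup>-\<^sup>\<beta>\<close>, while its standard deviation \<open>\<sigma>\<^sub>N\<close> is of order \<open>N\<close> to the power \<open>1/2 - \<beta>\<close>. So only
  about \<open>\<surd>N\<close> lattice points lie within \<open>2\<sigma>\<^sub>N\<close> of the origin, and by Chebyshev's inequality one of
  them is an atom of mass at least \<open>c/\<surd>N\<close>. The Edgeworth approximation is continuous in \<open>t\<close>, so its
  error is at least half of that, which is not \<open>o(\<sigma>\<^sub>N\<^sup>-\<^sup>s)\<close> once \<open>s (1 - 2\<beta>) \<ge> 1\<close>.\<close>

section \<open>Atoms as a lower bound for the Edgeworth error\<close>

text \<open>An atom is a jump of the distribution function, and a continuous \<open>G\<close> cannot
  follow it. Comparing the values at \<open>y\<close> and just to the left of \<open>y\<close> uses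
  the bound \<open>K\<close> twice, hence the factor 2.\<close>

lemma (in prob_space) prob_atom_le_cdf_error:
  fixes Y :: "'a \<Rightarrow> real"
  assumes [measurable]: "random_variable borel Y"
    and cont: "isCont G y"
    and err: "\<And>t. \<bar>prob {x \<in> space M. Y x \<le> t} - G t\<bar> \<le> K"
  shows "prob {x \<in> space M. Y x = y} \<le> 2 * K"
proof -
  have "prob {x \<in> space M. Y x = y} \<le> 2 * K + (G y - G (y - 1 / real (Suc n)))" for n
  proof -
    define z where "z = y - 1 / real (Suc n)"
    have "z < y" by (simp add: z_def)
    then have sub: "{x \<in> space M. Y x \<le> z} \<subseteq> {x \<in> space M. Y x \<le> y}" by auto
    have "prob {x \<in> space M. Y x = y}
        \<le> prob ({x \<in> space M. Y x \<le> y} - {x \<in> space M. Y x \<le> z})"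
      using \<open>z < y\<close> by (intro finite_measure_mono) auto
    also have "\<dots> = prob {x \<in> space M. Y x \<le> y} - prob {x \<in> space M. Y x \<le> z}"
      by (intro finite_measure_Diff sub) auto
    finally show ?thesis using err[of y] err[of z] unfolding z_def by linarith
  qed
  moreover have "(\<lambda>n. 2 * K + (G y - G (y - 1 / real (Suc n)))) \<longlonglongrightarrow> 2 * K + (G y - G (y - 0))"
  proof (intro tendsto_intros isCont_tendsto_compose[where g = G])
    show "isCont G (y - 0)" using cont by simp
    show "(\<lambda>n. 1 / real (Suc n)) \<longlonglongrightarrow> 0" by (rule LIMSEQ_Suc[OF lim_1_over_n])
  qed
  ultimately show ?thesis using LIMSEQ_le_const[of _ "2 * K + (G y - G (y - 0))"] by auto
qed

lemma isCont_cdf_std_normal: "isCont (cdf std_normal_distribution) x"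
proof -
  interpret real_distribution std_normal_distribution by (rule real_dist_normal_dist)
  have "AE y in lborel. y \<in> {x} \<longrightarrow> ennreal (std_normal_density y) = 0"
    using AE_lborel_singleton[of x] by eventually_elim simp
  then have "{x} \<in> null_sets std_normal_distribution"
    by (subst null_sets_density_iff) auto
  then show ?thesis by (simp add: isCont_cdf measure_eq_0_null_sets)
qed

lemma isCont_std_normal_density: "isCont std_normal_density x"
  unfolding std_normal_density_def by (intro continuous_intros) auto

text \<open>The exponential series gives
  \<open>\<bar>t\<bar> ^ k \<le> fact k * exp \<bar>t\<bar>\<close>, so a polynomial is at most a
  constant times \<open>exp \<bar>t\<bar>\<close>, which the Gaussian factor absorbs. This makes the
  supremum in the Edgeworth error one over a bounded set.\<close>

lemma bounded_poly_times_std_normal_density: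
  fixes p :: "real poly"
  shows "\<exists>C. \<forall>t. \<bar>poly p t * std_normal_density t\<bar> \<le> C"
proof -
  define A where "A = (\<Sum>k\<le>degree p. \<bar>coeff p k\<bar> * fact k)"
  have A: "A \<ge> 0" unfolding A_def by (intro sum_nonneg) auto
  have pow: "\<bar>t\<bar> ^ k \<le> fact k * exp \<bar>t\<bar>" for t :: real and k
  proof -
    have "\<bar>t\<bar> ^ k / fact k \<le> (\<Sum>m<Suc k. \<bar>t\<bar> ^ m / fact m)"
      by (rule member_le_sum[where f = "\<lambda>m. \<bar>t\<bar> ^ m / fact m"]) auto
    also have "\<dots> \<le> exp \<bar>t\<bar>"
    proof -
      obtain u where "exp \<bar>t\<bar> = (\<Sum>m<Suc k. \<bar>t\<bar> ^ m / fact m) + exp u / fact (Suc k) * \<bar>t\<bar> ^ Suc k"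
        using Maclaurin_exp_le[of "\<bar>t\<bar>" "Suc k"] by blast
      moreover have "exp u / fact (Suc k) * \<bar>t\<bar> ^ Suc k \<ge> 0" by simp
      ultimately show ?thesis by linarith
    qed
    finally show ?thesis by (simp add: field_simps)
  qed
  have "\<bar>poly p t * std_normal_density t\<bar> \<le> A * exp (1 / 2)" for t
  proof -
    have "\<bar>poly p t\<bar> \<le> (\<Sum>k\<le>degree p. \<bar>coeff p k\<bar> * \<bar>t\<bar> ^ k)"
      unfolding poly_altdef by (rule order.trans[OF sum_abs]) (simp add: abs_mult power_abs)
    also have "\<dots> \<le> (\<Sum>k\<le>degree p. \<bar>coeff p k\<bar> * (fact k * exp \<bar>t\<bar>))"
      by (intro sum_mono mult_left_mono pow) auto
    also have "\<dots> = A * exp \<bar>t\<bar>" unfolding A_def by (simp add: sum_distrib_right mult.assoc)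
    finally have P: "\<bar>poly p t\<bar> \<le> A * exp \<bar>t\<bar>" .
    have "1 / sqrt (2 * pi) \<le> 1" using pi_gt3 by (simp add: real_le_rsqrt)
    then have "1 / sqrt (2 * pi) * exp (- t\<^sup>2 / 2) \<le> 1 * exp (- t\<^sup>2 / 2)"
      by (intro mult_right_mono) auto
    then have D: "std_normal_density t \<le> exp (- t\<^sup>2 / 2)"
      by (simp only: std_normal_density_def mult_1_left)
    have "\<bar>poly p t * std_normal_density t\<bar> = \<bar>poly p t\<bar> * std_normal_density t"
      by (simp add: abs_mult)
    also have "\<dots> \<le> (A * exp \<bar>t\<bar>) * exp (- t\<^sup>2 / 2)"
      using A by (intro mult_mono P D) auto
    also have "\<dots> = A * exp (\<bar>t\<bar> - t\<^sup>2 / 2)" by (simp add: exp_add[symmetric])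
    \<comment> \<open>The exponent is at most 1/2 because \<open>(\<bar>t\<bar> - 1)\<^sup>2\<close>
      is nonnegative.\<close>
    also have "\<dots> \<le> A * exp (1 / 2)"
      using A zero_le_power2[of "\<bar>t\<bar> - 1"]
      by (intro mult_left_mono) (auto simp: power2_eq_square algebra_simps)
    finally show ?thesis .
  qed
  then show ?thesis by blast
qed

text \<open>For fixed \<open>N\<close> the normal distribution function plus the correction terms
  \<open>Q\<close> is continuous in \<open>t\<close>, so the bound on atoms applies to the
  standardized sum with this approximation as \<open>G\<close>.\<close>

lemma (in prob_space) prob_atom_le_edgeworth_error:
  assumes meas: "random_variable borel (S N)" and pos: "std_dev M (S N) > 0"
  shows "prob {x \<in> space M. S N x = y} \<le> 2 * (SUP t. \<bar>edgeworth_error M S s P N t\<bar>)"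
proof -
  let ?\<sigma> = "std_dev M (S N)" and ?Y = "standardized M (S N)"
  define Q where "Q t = (\<Sum>j=1..s. (1 / ?\<sigma> ^ j) * poly (P j N) t * std_normal_density t)" for t
  obtain C where C: "\<And>j t. \<bar>poly (P j N) t * std_normal_density t\<bar> \<le> C j"
    using bounded_poly_times_std_normal_density[of "P _ N"] by metis
  interpret std_normal: real_distribution std_normal_distribution by (rule real_dist_normal_dist)
  have Q: "\<bar>Q t\<bar> \<le> (\<Sum>j=1..s. (1 / ?\<sigma> ^ j) * C j)" for t
    unfolding Q_def
  proof (intro order.trans[OF sum_abs] sum_mono)
    fix j
    have "\<bar>(1 / ?\<sigma> ^ j) * poly (P j N) t * std_normal_density t\<bar>
        = (1 / ?\<sigma> ^ j) * \<bar>poly (P j N) t * std_normal_density t\<bar>"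
      using pos by (simp add: abs_mult)
    also have "\<dots> \<le> (1 / ?\<sigma> ^ j) * C j"
      using pos by (intro mult_left_mono C) simp
    finally show "\<bar>(1 / ?\<sigma> ^ j) * poly (P j N) t * std_normal_density t\<bar> \<le> (1 / ?\<sigma> ^ j) * C j" .
  qed
  \<comment> \<open>A real \<open>SUP\<close> dominates its members only once the set is known to be
    bounded above.\<close>
  have bdd: "bdd_above (range (\<lambda>t. \<bar>edgeworth_error M S s P N t\<bar>))"
  proof (rule bdd_aboveI2)
    fix t
    have "\<bar>prob {x \<in> space M. ?Y x \<le> t}\<bar> \<le> 1" "\<bar>cdf std_normal_distribution t\<bar> \<le> 1"
      by (auto simp: std_normal.cdf_nonneg std_normal.cdf_bounded_prob)
    then show "\<bar>edgeworth_error M S s P N t\<bar> \<le> 2 + (\<Sum>j=1..s. (1 / ?\<sigma> ^ j) * C j)"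
      using Q[of t] unfolding edgeworth_error_def Q_def[symmetric] by linarith
  qed
  have [measurable]: "random_variable borel ?Y"
    using meas unfolding standardized_def[abs_def] by simp
  have "prob {x \<in> space M. ?Y x = (y - expectation (S N)) / ?\<sigma>}
      \<le> 2 * (SUP t. \<bar>edgeworth_error M S s P N t\<bar>)"
  proof (rule prob_atom_le_cdf_error[where G = "\<lambda>t. cdf std_normal_distribution t + Q t"])
    show "isCont (\<lambda>t. cdf std_normal_distribution t + Q t) ((y - expectation (S N)) / ?\<sigma>)"
      unfolding Q_def using isCont_std_normal_density
      by (intro continuous_intros isCont_cdf_std_normal) auto
    fix t
    have "\<bar>edgeworth_error M S s P N t\<bar> \<le> (SUP t. \<bar>edgeworth_error M S s P N t\<bar>)"
      by (rule cSUP_upper[OF _ bdd]) simp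
    then show "\<bar>prob {x \<in> space M. ?Y x \<le> t} - (cdf std_normal_distribution t + Q t)\<bar>
        \<le> (SUP t. \<bar>edgeworth_error M S s P N t\<bar>)"
      unfolding edgeworth_error_def Q_def[symmetric] diff_diff_eq .
  qed simp
  \<comment> \<open>Standardizing is injective when the standard deviation is positive, so both
    atoms are the same event.\<close>
  then show ?thesis using pos by (simp add: standardized_def)
qed

section \<open>Large atoms of lattice variables\<close>

text \<open>By Chebyshev's inequality, mass at least 3/4 lies within two standard deviations of the
  mean. That window holds at most \<open>1 + 4 * std_dev M Y / h\<close> lattice points, so by
  pigeonhole one of them carries at least the average share.\<close>

lemma (in prob_space) lattice_atom_exists:
  fixes Y :: "'a \<Rightarrow> real"
  assumes [measurable]: "random_variable borel Y"
    and int: "integrable M (\<lambda>x. (Y x)\<^sup>2)" and mean: "expectation Y = 0"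
    and pos: "std_dev M Y > 0" and h: "h > 0"
    and lattice: "\<And>x. x \<in> space M \<Longrightarrow> \<exists>k::int. Y x = h * of_int k"
  shows "\<exists>y. prob {x \<in> space M. Y x = y} * (1 + 4 * std_dev M Y / h) \<ge> 3 / 4"
proof -
  let ?\<sigma> = "std_dev M Y"
  define m where "m = \<lfloor>2 * ?\<sigma> / h\<rfloor>"
  have m: "0 \<le> m" "real_of_int m \<le> 2 * ?\<sigma> / h" using pos h by (auto simp: m_def)
  have var: "variance Y = ?\<sigma>\<^sup>2"
    unfolding std_dev_def by (rule real_sqrt_pow2[symmetric]) (rule variance_positive)
  have "prob {x \<in> space M. \<bar>Y x - expectation Y\<bar> \<ge> 2 * ?\<sigma>} \<le> variance Y / (2 * ?\<sigma>)\<^sup>2"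
    by (rule Chebyshev_inequality) (use pos int in auto)
  then have cheb: "prob {x \<in> space M. \<bar>Y x\<bar> \<ge> 2 * ?\<sigma>} \<le> 1 / 4"
    using pos unfolding var unfolding mean by (simp add: power_mult_distrib)
  have "prob (space M - {x \<in> space M. \<bar>Y x\<bar> \<ge> 2 * ?\<sigma>}) = 1 - prob {x \<in> space M. \<bar>Y x\<bar> \<ge> 2 * ?\<sigma>}"
    by (intro prob_compl) measurable
  then have "3 / 4 \<le> prob (space M - {x \<in> space M. \<bar>Y x\<bar> \<ge> 2 * ?\<sigma>})"
    using cheb by linarith
  also have "\<dots> \<le> prob (\<Union>k\<in>{-m..m}. {x \<in> space M. Y x = h * of_int k})"
  proof (intro finite_measure_mono subsetI)
    fix x assume "x \<in> space M - {x \<in> space M. \<bar>Y x\<bar> \<ge> 2 * ?\<sigma>}"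
    then have x: "x \<in> space M" "\<bar>Y x\<bar> < 2 * ?\<sigma>" by auto
    obtain k :: int where k: "Y x = h * of_int k" using lattice[OF x(1)] by blast
    have "real_of_int \<bar>k\<bar> \<le> 2 * ?\<sigma> / h"
      using x(2) h unfolding k by (simp add: abs_mult field_simps)
    then have "\<bar>k\<bar> \<le> m" unfolding m_def le_floor_iff .
    then show "x \<in> (\<Union>k\<in>{-m..m}. {x \<in> space M. Y x = h * of_int k})"
      using x(1) k by (intro UN_I[of k]) auto
  qed measurable
  also have "\<dots> \<le> (\<Sum>k\<in>{-m..m}. prob {x \<in> space M. Y x = h * of_int k})"
    by (intro finite_measure_subadditive_finite) auto
  finally have sum: "3 / 4 \<le> (\<Sum>k\<in>{-m..m}. prob {x \<in> space M. Y x = h * of_int k})" .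
  \<comment> \<open>The heaviest lattice point of the window serves as the witness.\<close>
  define p where "p = Max ((\<lambda>k. prob {x \<in> space M. Y x = h * of_int k}) ` {-m..m})"
  have "p \<in> (\<lambda>k. prob {x \<in> space M. Y x = h * of_int k}) ` {-m..m}"
    unfolding p_def using m by (intro Max_in) auto
  then obtain k where k: "p = prob {x \<in> space M. Y x = h * of_int k}" by blast
  have "(\<Sum>k\<in>{-m..m}. prob {x \<in> space M. Y x = h * of_int k}) \<le> real (card {-m..m}) * p"
    by (rule sum_bounded_above) (simp add: p_def)
  also have "real (card {-m..m}) = 1 + 2 * real_of_int m" using m by simp
  also have "(1 + 2 * real_of_int m) * p \<le> (1 + 4 * ?\<sigma> / h) * p"
    by (rule mult_right_mono) (use m in \<open>auto simp: k\<close>)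
  finally have "3 / 4 \<le> p * (1 + 4 * ?\<sigma> / h)" using sum by (simp add: mult.commute)
  then show ?thesis unfolding k by (rule exI)
qed

text \<open>If the window has at most \<open>C * \<sigma> ^ s\<close> lattice points, some atom has
  mass of order at least \<open>1 / \<sigma> ^ s\<close>, and the error, being at least half of it,
  is not of smaller order. The conditions are asked only eventually, since an empty sum has standard
  deviation 0.\<close>

lemma (in prob_space) lattice_not_edgeworth_expansion:
  assumes S: "\<And>N. random_variable borel (S N)" "\<And>N. integrable M (\<lambda>x. (S N x)\<^sup>2)"
      "\<And>N. expectation (S N) = 0"
    and lattice: "\<forall>\<^sub>F N in sequentially. h N > 0 \<and> std_dev M (S N) > 0 \<and>
      (\<forall>x\<in>space M. \<exists>k::int. S N x = h N * of_int k) \<and>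
      1 + 4 * std_dev M (S N) / h N \<le> C * std_dev M (S N) ^ s"
  shows "\<not> edgeworth_expansion M S s"
proof
  assume "edgeworth_expansion M S s"
  then obtain P where
    o: "(\<lambda>N. SUP t. \<bar>edgeworth_error M S s P N t\<bar>) \<in> o(\<lambda>N. 1 / std_dev M (S N) ^ s)"
    unfolding edgeworth_expansion_def by blast
  \<comment> \<open>Chosen so that \<open>2 * c * C\<close> is at most 1/2, below the mass 3/4; the
    maximum keeps \<open>c\<close> positive whatever the sign of \<open>C\<close>.\<close>
  define c where "c = 1 / (4 * max C 1)"
  have "c > 0" by (simp add: c_def)
  have cC: "2 * c * C < 3 / 4" by (auto simp: c_def field_simps max_def)
  have "\<forall>\<^sub>F N in sequentially. False"
    using landau_o.smallD[OF o \<open>c > 0\<close>] lattice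
  proof eventually_elim
    case (elim N)
    let ?\<sigma> = "std_dev M (S N)" and ?E = "SUP t. \<bar>edgeworth_error M S s P N t\<bar>"
    obtain y where y: "3 / 4 \<le> prob {x \<in> space M. S N x = y} * (1 + 4 * ?\<sigma> / h N)"
      using lattice_atom_exists[OF S, of N "h N"] elim by blast
    have atom: "prob {x \<in> space M. S N x = y} \<le> 2 * ?E"
      by (rule prob_atom_le_edgeworth_error) (use S elim in auto)
    have "?E \<le> c * (1 / ?\<sigma> ^ s)" using elim by auto
    then have "prob {x \<in> space M. S N x = y} \<le> 2 * (c * (1 / ?\<sigma> ^ s))"
      using atom by linarith
    then have "prob {x \<in> space M. S N x = y} * (1 + 4 * ?\<sigma> / h N)
        \<le> (2 * (c * (1 / ?\<sigma> ^ s))) * (C * ?\<sigma> ^ s)"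
      using elim \<open>c > 0\<close> by (intro mult_mono) auto
    also have "\<dots> = 2 * c * C" using elim by simp
    finally show False using y cC by linarith
  qed
  then show False by simp
qed

section \<open>Second moments of independent sums and independence of coordinates\<close>

text \<open>The cross term factors by independence and vanishes because the new summand is centered.
  Integrability is part of the conclusion so that the induction can carry it along.\<close>

lemma (in prob_space) expectation_square_sum_indep:
  fixes X :: "'i \<Rightarrow> 'a \<Rightarrow> real"
  assumes "finite I" "indep_vars (\<lambda>_. borel) X I"
    and "\<And>i. i \<in> I \<Longrightarrow> integrable M (X i)" "\<And>i. i \<in> I \<Longrightarrow> expectation (X i) = 0"
    and "\<And>i. i \<in> I \<Longrightarrow> integrable M (\<lambda>x. (X i x)\<^sup>2)"
  shows "integrable M (\<lambda>x. (\<Sum>i\<in>I. X i x)\<^sup>2) \<and>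
    expectation (\<lambda>x. (\<Sum>i\<in>I. X i x)\<^sup>2) = (\<Sum>i\<in>I. expectation (\<lambda>x. (X i x)\<^sup>2))"
  using assms
proof (induction I rule: finite_induct)
  case (insert i I)
  let ?S = "\<lambda>x. \<Sum>i\<in>I. X i x"
  have IH: "integrable M (\<lambda>x. (?S x)\<^sup>2)"
    "expectation (\<lambda>x. (?S x)\<^sup>2) = (\<Sum>i\<in>I. expectation (\<lambda>x. (X i x)\<^sup>2))"
    using insert indep_vars_subset[OF insert.prems(1)] by auto
  have ind: "indep_var borel (X i) borel ?S"
    by (rule indep_vars_sum) (use insert in auto)
  have int: "integrable M (X i)" "integrable M ?S" "integrable M (\<lambda>x. (X i x)\<^sup>2)"
    using insert.prems by auto
  have cross: "integrable M (\<lambda>x. X i x * ?S x)" "expectation (\<lambda>x. X i x * ?S x) = 0"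
    using indep_var_integrable[OF ind int(1,2)] indep_var_lebesgue_integral[OF ind int(1,2)]
      insert.prems by auto
  have eq: "(\<lambda>x. (\<Sum>i\<in>insert i I. X i x)\<^sup>2)
      = (\<lambda>x. ((X i x)\<^sup>2 + (?S x)\<^sup>2) + 2 * (X i x * ?S x))"
    using insert.hyps by (auto simp: power2_sum)
  show ?case
    unfolding eq using insert.hyps int cross IH by simp
qed (simp add: prob_space)

text \<open>Independence means that the joint law is the product of the marginals; the joint law of
  all coordinates is the product measure itself.\<close>

lemma indep_vars_PiM_coordinate:
  assumes "\<And>i. prob_space (M i)"
  shows "prob_space.indep_vars (PiM UNIV M) M (\<lambda>i x. x i) UNIV"
proof -
  interpret prob_space "PiM UNIV M" by (rule prob_space_PiM) (rule assms)
  have "distr (PiM UNIV M) (PiM UNIV M) (\<lambda>x. \<lambda>i\<in>UNIV. x i) = PiM UNIV M"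
    by (simp add: restrict_UNIV distr_id2)
  moreover have "distr (PiM UNIV M) (M i) (\<lambda>x. x i) = M i" for i
    by (rule distr_PiM_component) (auto intro: assms)
  ultimately show ?thesis
    by (subst indep_vars_iff_distr_eq_PiM) auto
qed

section \<open>Power sums and dyadic step sizes\<close>

text \<open>A telescoping form of the comparison with an integral: by the mean value theorem each
  increment of \<open>x powr \<gamma> / \<gamma>\<close> dominates the next term, as
  \<open>x powr (\<gamma> - 1)\<close> decreases.\<close>

lemma sum_powr_le:
  fixes \<gamma> :: real
  assumes "0 < \<gamma>" "\<gamma> < 1"
  shows "(\<Sum>n=1..N. real n powr (\<gamma> - 1)) \<le> real N powr \<gamma> / \<gamma>"
proof (induction N)
  case (Suc N)
  have "\<gamma> * real (Suc N) powr (\<gamma> - 1) \<le> real (Suc N) powr \<gamma> - real N powr \<gamma>"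
  proof (cases "N = 0")
    case False
    have "\<exists>z>real N. z < real (Suc N) \<and> real (Suc N) powr \<gamma> - real N powr \<gamma>
        = (real (Suc N) - real N) * (\<gamma> * z powr (\<gamma> - 1))"
      using False by (intro MVT2) (auto intro!: derivative_eq_intros)
    then obtain z where z: "z > real N" "z < real (Suc N)"
      "real (Suc N) powr \<gamma> - real N powr \<gamma> = \<gamma> * z powr (\<gamma> - 1)" by auto
    have "real (Suc N) powr (\<gamma> - 1) \<le> z powr (\<gamma> - 1)"
      using z assms by (intro powr_mono2') auto
    then show ?thesis using z assms by simp
  qed (use assms in auto)
  then have "real (Suc N) powr (\<gamma> - 1) \<le> real (Suc N) powr \<gamma> / \<gamma> - real N powr \<gamma> / \<gamma>"
    using assms by (simp add: field_simps)
  then show ?case using Suc by simp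
qed simp

text \<open>For positive \<open>\<beta>\<close> and \<open>n\<close>, this is
  \<open>n powr (- \<beta>)\<close> rounded up to a power of 1/2. The rounding makes all earlier
  steps integer multiples of the current one, so that partial sums live on a lattice.\<close>

definition dyadic_step :: "real \<Rightarrow> nat \<Rightarrow> real" where
  "dyadic_step \<beta> n = (1 / 2) ^ nat \<lfloor>\<beta> * log 2 (real n)\<rfloor>"

lemma dyadic_step_pos: "dyadic_step \<beta> n > 0"
  by (simp add: dyadic_step_def)

text \<open>Rounding the exponent down changes it by less than 1, hence the power of 2 by a factor
  below 2.\<close>

lemma dyadic_step_bounds:
  assumes "0 < \<beta>" "n \<ge> 1"
  shows "real n powr (- \<beta>) \<le> dyadic_step \<beta> n" "dyadic_step \<beta> n \<le> 2 * real n powr (- \<beta>)"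
proof -
  let ?l = "\<beta> * log 2 (real n)"
  \<comment> \<open>Nonnegativity ensures that \<open>nat\<close> does not truncate the
    exponent.\<close>
  have "?l \<ge> 0" using assms by simp
  then have "real (nat \<lfloor>?l\<rfloor>) = of_int \<lfloor>?l\<rfloor>" by simp
  then have step: "dyadic_step \<beta> n = 2 powr (- of_int \<lfloor>?l\<rfloor>)"
    by (simp add: dyadic_step_def powr_minus powr_realpow[symmetric] power_one_over inverse_eq_divide
        del: of_nat_nat)
  have eq: "real n powr (- \<beta>) = 2 powr (- ?l)"
    using assms by (simp add: powr_def log_def)
  show "real n powr (- \<beta>) \<le> dyadic_step \<beta> n"
    unfolding step eq by (intro powr_mono) auto
  have "dyadic_step \<beta> n \<le> 2 powr (1 + (- ?l))"
    unfolding step by (intro powr_mono) linarith+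
  then show "dyadic_step \<beta> n \<le> 2 * real n powr (- \<beta>)"
    unfolding eq powr_add by simp
qed

text \<open>The exponents increase with the index, so the quotient of an earlier step by a later one
  is a power of 2 with natural exponent.\<close>

lemma dyadic_step_multiple:
  assumes "0 < \<beta>" "1 \<le> n" "n \<le> N"
  shows "\<exists>k::int. dyadic_step \<beta> n = dyadic_step \<beta> N * of_int k"
proof -
  let ?m = "\<lambda>n. nat \<lfloor>\<beta> * log 2 (real n)\<rfloor>"
  have "?m n \<le> ?m N"
    using assms by (intro nat_mono floor_mono mult_left_mono) auto
  then have "(2::real) ^ ?m N = 2 ^ ?m n * 2 ^ (?m N - ?m n)"
    by (simp add: power_add[symmetric])
  then have "dyadic_step \<beta> n = dyadic_step \<beta> N * of_int (2 ^ (?m N - ?m n))"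
    by (simp add: dyadic_step_def power_one_over field_simps)
  then show ?thesis by blast
qed

text \<open>This sum will be the variance. From below, each of the \<open>N\<close> terms is at
  least \<open>N powr (- 2 * \<beta>)\<close>; from above, \<open>sum_powr_le\<close> applies with
  exponent \<open>1 - 2 * \<beta>\<close>, and the 4 is the square of the rounding factor.\<close>

lemma sum_dyadic_step_squared_bounds:
  assumes "0 < \<beta>" "\<beta> < 1 / 2" "N \<ge> 1"
  shows "real N powr (1 - 2 * \<beta>) \<le> (\<Sum>n=1..N. (dyadic_step \<beta> n)\<^sup>2)"
    and "(\<Sum>n=1..N. (dyadic_step \<beta> n)\<^sup>2) \<le> 4 / (1 - 2 * \<beta>) * real N powr (1 - 2 * \<beta>)"
proof -
  have sq: "(real n powr (- \<beta>))\<^sup>2 = real n powr (- 2 * \<beta>)" if "n \<ge> 1" for n :: nat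
    using that by (simp add: powr_powr mult.commute flip: powr_realpow)
  have "real N powr (1 - 2 * \<beta>) = real N * real N powr (- 2 * \<beta>)"
    using assms by (simp add: powr_diff powr_minus field_simps)
  also have "\<dots> = (\<Sum>n=1..N. real N powr (- 2 * \<beta>))" by simp
  also have "\<dots> \<le> (\<Sum>n=1..N. (dyadic_step \<beta> n)\<^sup>2)"
  proof (rule sum_mono)
    fix n assume n: "n \<in> {1..N}"
    have "real N powr (- 2 * \<beta>) \<le> real n powr (- 2 * \<beta>)"
      using n assms by (intro powr_mono2') auto
    also have "\<dots> = (real n powr (- \<beta>))\<^sup>2" using n sq by simp
    also have "\<dots> \<le> (dyadic_step \<beta> n)\<^sup>2"
      using n assms dyadic_step_bounds by (intro power_mono) auto
    finally show "real N powr (- 2 * \<beta>) \<le> (dyadic_step \<beta> n)\<^sup>2" .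
  qed
  finally show "real N powr (1 - 2 * \<beta>) \<le> (\<Sum>n=1..N. (dyadic_step \<beta> n)\<^sup>2)" .
  have "(\<Sum>n=1..N. (dyadic_step \<beta> n)\<^sup>2) \<le> (\<Sum>n=1..N. 4 * real n powr ((1 - 2 * \<beta>) - 1))"
  proof (rule sum_mono)
    fix n assume n: "n \<in> {1..N}"
    have "(dyadic_step \<beta> n)\<^sup>2 \<le> (2 * real n powr (- \<beta>))\<^sup>2"
      using n assms dyadic_step_bounds dyadic_step_pos[of \<beta> n] by (intro power_mono) auto
    then show "(dyadic_step \<beta> n)\<^sup>2 \<le> 4 * real n powr ((1 - 2 * \<beta>) - 1)"
      using n sq by (simp add: power_mult_distrib)
  qed
  also have "\<dots> \<le> 4 * (real N powr (1 - 2 * \<beta>) / (1 - 2 * \<beta>))"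
    unfolding sum_distrib_left[symmetric] using assms
    by (intro mult_left_mono sum_powr_le) auto
  finally show "(\<Sum>n=1..N. (dyadic_step \<beta> n)\<^sup>2) \<le> 4 / (1 - 2 * \<beta>) * real N powr (1 - 2 * \<beta>)"
    by simp
qed

section \<open>The random signs and their partial sums\<close>

text \<open>Taking the sign of the coordinate, instead of the coordinate itself, makes the variable
  two-valued everywhere and not just almost surely.\<close>

definition sign_step :: "real \<Rightarrow> nat \<Rightarrow> (nat \<Rightarrow> real) \<Rightarrow> real" where
  "sign_step \<beta> n x = dyadic_step \<beta> n * (if x n > 0 then 1 else - 1)"

abbreviation coin_flips :: "(nat \<Rightarrow> real) measure" where
  "coin_flips \<equiv> PiM UNIV (\<lambda>_. measure_pmf (pmf_of_set {-1, 1}))"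

lemma abs_sign_step: "\<bar>sign_step \<beta> n x\<bar> = dyadic_step \<beta> n"
  using dyadic_step_pos[of \<beta> n] by (simp add: sign_step_def)

interpretation coin_flips: prob_space coin_flips
  by (intro prob_space_PiM measure_pmf.prob_space_axioms)

text \<open>Each variable is a function of its own coordinate, and on the discrete coordinate spaces
  every function is measurable.\<close>

lemma indep_vars_sign_step: "coin_flips.indep_vars (\<lambda>_. borel) (sign_step \<beta>) I"
proof -
  have "coin_flips.indep_vars (\<lambda>_. borel)
      (\<lambda>n x. dyadic_step \<beta> n * (if x n > 0 then 1 else - 1)) UNIV"
    by (rule coin_flips.indep_vars_compose2[OF indep_vars_PiM_coordinate])
       (auto intro: measure_pmf.prob_space_axioms)
  then have "coin_flips.indep_vars (\<lambda>_. borel) (sign_step \<beta>) UNIV"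
    by (simp add: sign_step_def[abs_def])
  then show ?thesis by (rule coin_flips.indep_vars_subset) simp
qed

lemma borel_measurable_sign_step [measurable]: "sign_step \<beta> n \<in> borel_measurable coin_flips"
  using indep_vars_sign_step[of \<beta> UNIV] unfolding coin_flips.indep_vars_def by simp

lemma integrable_sign_step: "integrable coin_flips (sign_step \<beta> n)"
  by (rule coin_flips.integrable_const_bound[where B = "dyadic_step \<beta> n"]) (auto simp: abs_sign_step)

lemma sign_step_squared: "(sign_step \<beta> n x)\<^sup>2 = (dyadic_step \<beta> n)\<^sup>2"
  by (metis abs_sign_step power2_abs)

lemma expectation_sign_step: "coin_flips.expectation (sign_step \<beta> n) = 0"
proof -
  let ?coin = "pmf_of_set {-1, 1 :: real}"
  let ?f = "\<lambda>y::real. dyadic_step \<beta> n * (if y > 0 then 1 else - 1)"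
  have "coin_flips.expectation (sign_step \<beta> n) = coin_flips.expectation (\<lambda>x. ?f (x n))"
    by (simp add: sign_step_def[abs_def])
  also have "\<dots> = integral\<^sup>L (distr coin_flips (measure_pmf ?coin) (\<lambda>x. x n)) ?f"
    by (rule integral_distr[symmetric]) auto
  also have "distr coin_flips (measure_pmf ?coin) (\<lambda>x. x n) = measure_pmf ?coin"
    by (rule distr_PiM_component) (auto intro: measure_pmf.prob_space_axioms)
  also have "measure_pmf.expectation ?coin ?f = 0"
    by (subst integral_pmf_of_set) auto
  finally show ?thesis .
qed

lemma partial_sum_sign_step:
  shows "partial_sum (sign_step \<beta>) N \<in> borel_measurable coin_flips"
    and "integrable coin_flips (\<lambda>x. (partial_sum (sign_step \<beta>) N x)\<^sup>2)"
    and "coin_flips.expectation (partial_sum (sign_step \<beta>) N) = 0"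
    and "coin_flips.variance (partial_sum (sign_step \<beta>) N) = (\<Sum>n=1..N. (dyadic_step \<beta> n)\<^sup>2)"
proof -
  show "partial_sum (sign_step \<beta>) N \<in> borel_measurable coin_flips"
    unfolding partial_sum_def[abs_def] by measurable
  show mean: "coin_flips.expectation (partial_sum (sign_step \<beta>) N) = 0"
    unfolding partial_sum_def[abs_def] by (simp add: integrable_sign_step expectation_sign_step)
  have sq: "integrable coin_flips (\<lambda>x. (\<Sum>n=1..N. sign_step \<beta> n x)\<^sup>2) \<and>
      coin_flips.expectation (\<lambda>x. (\<Sum>n=1..N. sign_step \<beta> n x)\<^sup>2)
        = (\<Sum>n=1..N. coin_flips.expectation (\<lambda>x. (sign_step \<beta> n x)\<^sup>2))"
    by (rule coin_flips.expectation_square_sum_indep)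
       (auto simp: indep_vars_sign_step integrable_sign_step expectation_sign_step sign_step_squared)
  then show "integrable coin_flips (\<lambda>x. (partial_sum (sign_step \<beta>) N x)\<^sup>2)"
    by (simp add: partial_sum_def)
  show "coin_flips.variance (partial_sum (sign_step \<beta>) N) = (\<Sum>n=1..N. (dyadic_step \<beta> n)\<^sup>2)"
    unfolding mean using sq by (simp add: partial_sum_def sign_step_squared coin_flips.prob_space)
qed

text \<open>The last step is the finest one and divides all the earlier ones; a sign only negates
  the integer factor.\<close>

lemma partial_sum_sign_step_lattice:
  assumes "0 < \<beta>"
  shows "\<exists>k::int. partial_sum (sign_step \<beta>) N x = dyadic_step \<beta> N * of_int k"
proof -
  have "\<exists>k::int. sign_step \<beta> n x = dyadic_step \<beta> N * of_int k" if n: "n \<in> {1..N}" for n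
  proof -
    obtain k :: int where "dyadic_step \<beta> n = dyadic_step \<beta> N * of_int k"
      using dyadic_step_multiple[of \<beta> n N] assms n by auto
    then have "sign_step \<beta> n x = dyadic_step \<beta> N * of_int (if x n > 0 then k else - k)"
      by (simp add: sign_step_def)
    then show ?thesis by blast
  qed
  then obtain k :: "nat \<Rightarrow> int"
    where "\<And>n. n \<in> {1..N} \<Longrightarrow> sign_step \<beta> n x = dyadic_step \<beta> N * of_int (k n)"
    by metis
  then have "partial_sum (sign_step \<beta>) N x = dyadic_step \<beta> N * of_int (\<Sum>n=1..N. k n)"
    by (simp add: partial_sum_def sum_distrib_left)
  then show ?thesis by blast
qed

section \<open>Failure of the expansion for the random signs\<close>

text \<open>The standard deviation divided by the mesh is at most a constant times
  \<open>N powr (1 / 2)\<close>. The threshold on \<open>s\<close> is exactly where the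
  \<open>s\<close>-th power of \<open>N powr (1 / 2 - \<beta>)\<close> reaches that order.\<close>

lemma sign_step_not_edgeworth_expansion:
  assumes \<beta>: "0 < \<beta>" "\<beta> < 1 / 2" and s: "real s \<ge> 1 / (1 - 2 * \<beta>)"
  shows "\<not> edgeworth_expansion coin_flips (partial_sum (sign_step \<beta>)) s"
proof (rule coin_flips.lattice_not_edgeworth_expansion)
  \<comment> \<open>The square root of the constant in the upper bound for the variance.\<close>
  define D where "D = sqrt (4 / (1 - 2 * \<beta>))"
  have "D \<ge> 0" using \<beta> by (simp add: D_def)
  show "\<forall>\<^sub>F N in sequentially. dyadic_step \<beta> N > 0 \<and>
      std_dev coin_flips (partial_sum (sign_step \<beta>) N) > 0 \<and>
      (\<forall>x\<in>space coin_flips. \<exists>k::int. partial_sum (sign_step \<beta>) N x = dyadic_step \<beta> N * of_int k) \<and>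
      1 + 4 * std_dev coin_flips (partial_sum (sign_step \<beta>) N) / dyadic_step \<beta> N
        \<le> (1 + 4 * D) * std_dev coin_flips (partial_sum (sign_step \<beta>) N) ^ s"
    using eventually_ge_at_top[of 1]
  proof eventually_elim
    case (elim N)
    define \<sigma> where "\<sigma> = std_dev coin_flips (partial_sum (sign_step \<beta>) N)"
    have \<sigma>: "\<sigma> = sqrt (\<Sum>n=1..N. (dyadic_step \<beta> n)\<^sup>2)"
      by (simp only: \<sigma>_def std_dev_def partial_sum_sign_step(4))
    have sqrt_powr: "sqrt (real N powr (1 - 2 * \<beta>)) = real N powr (1 / 2 - \<beta>)"
      using elim by (simp add: powr_powr diff_divide_distrib flip: powr_half_sqrt)
    have lower: "real N powr (1 / 2 - \<beta>) \<le> \<sigma>"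
      unfolding \<sigma> sqrt_powr[symmetric]
      by (intro real_sqrt_le_mono sum_dyadic_step_squared_bounds) (use \<beta> elim in auto)
    have "\<sigma> \<le> sqrt (4 / (1 - 2 * \<beta>) * real N powr (1 - 2 * \<beta>))"
      unfolding \<sigma> by (intro real_sqrt_le_mono sum_dyadic_step_squared_bounds) (use \<beta> elim in auto)
    also have "\<dots> = D * real N powr (1 / 2 - \<beta>)"
      by (simp only: real_sqrt_mult D_def sqrt_powr)
    finally have upper: "\<sigma> \<le> D * real N powr (1 / 2 - \<beta>)" .
    have pos: "\<sigma> > 0" using lower elim by (intro less_le_trans[OF _ lower]) simp
    have "\<sigma> / dyadic_step \<beta> N \<le> (D * real N powr (1 / 2 - \<beta>)) / real N powr (- \<beta>)"
      using upper \<open>D \<ge> 0\<close> elim \<beta> dyadic_step_bounds[of \<beta> N] by (intro frac_le) auto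
    also have "\<dots> = D * real N powr ((1 / 2 - \<beta>) - (- \<beta>))"
      by (simp only: powr_diff times_divide_eq_right)
    also have "\<dots> = D * real N powr (1 / 2)" by simp
    finally have ratio: "\<sigma> / dyadic_step \<beta> N \<le> D * real N powr (1 / 2)" .
    have "1 / 2 \<le> (1 / 2 - \<beta>) * real s"
      using s \<beta> by (simp add: field_simps)
    then have "real N powr (1 / 2) \<le> real N powr ((1 / 2 - \<beta>) * real s)"
      using elim by (intro powr_mono) auto
    also have "\<dots> = (real N powr (1 / 2 - \<beta>)) ^ s"
      using elim by (simp add: powr_powr flip: powr_realpow)
    also have "\<dots> \<le> \<sigma> ^ s" by (intro power_mono lower) simp
    finally have half: "real N powr (1 / 2) \<le> \<sigma> ^ s" .
    \<comment> \<open>The summand 1 in the count of lattice points is absorbed into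
      \<open>\<sigma> ^ s\<close> as well, which gives the constant
      \<open>1 + 4 * D\<close>.\<close>
    have "1 \<le> real N powr (1 / 2)" using elim by (intro ge_one_powr_ge_zero) auto
    then have "1 \<le> \<sigma> ^ s" using half by linarith
    moreover have "\<sigma> / dyadic_step \<beta> N \<le> D * \<sigma> ^ s"
      using ratio mult_left_mono[OF half \<open>D \<ge> 0\<close>] by linarith
    ultimately have "1 + 4 * (\<sigma> / dyadic_step \<beta> N) \<le> (1 + 4 * D) * \<sigma> ^ s"
      unfolding distrib_right by linarith
    then have "1 + 4 * \<sigma> / dyadic_step \<beta> N \<le> (1 + 4 * D) * \<sigma> ^ s" by simp
    then show ?case
      using pos dyadic_step_pos partial_sum_sign_step_lattice[OF \<beta>(1)]
      unfolding \<sigma>_def by blast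
  qed
qed (rule partial_sum_sign_step)+

theorem theorem5:
  fixes \<beta> :: real
  assumes "0 < \<beta>" and "\<beta> < 1 / 2"
  shows "\<exists>(M :: (nat \<Rightarrow> real) measure) (X :: nat \<Rightarrow> (nat \<Rightarrow> real) \<Rightarrow> real).
    prob_space M \<and>
    prob_space.indep_vars M (\<lambda>_. borel) X {1..} \<and>
    (\<forall>n\<ge>1. integrable M (X n) \<and> prob_space.expectation M (X n) = 0 \<and>
            integrable M (\<lambda>x. (X n x)\<^sup>2)) \<and>
    (\<exists>C1>0. \<exists>C2>0. \<forall>\<^sub>F n in sequentially.
        ereal (C1 * real n powr (- \<beta>)) \<le> Linf_norm M (X n) \<and>
        Linf_norm M (X n) \<le> ereal (C2 * real n powr (- \<beta>))) \<and>
    (\<exists>c1>0. \<exists>c2>0. \<forall>\<^sub>F N in sequentially.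
        c1 \<le> prob_space.variance M (partial_sum X N) / real N powr (1 - 2 * \<beta>) \<and>
        prob_space.variance M (partial_sum X N) / real N powr (1 - 2 * \<beta>) \<le> c2) \<and>
    (\<forall>s :: nat. real s > 1 / (1 - 2 * \<beta>) \<longrightarrow> \<not> edgeworth_expansion M (partial_sum X) s)"
proof (intro exI[of _ coin_flips] exI[of _ "sign_step \<beta>"] conjI allI impI)
  show "prob_space coin_flips" by (rule coin_flips.prob_space_axioms)
  show "coin_flips.indep_vars (\<lambda>_. borel) (sign_step \<beta>) {1..}" by (rule indep_vars_sign_step)
  show "integrable coin_flips (sign_step \<beta> n)" for n by (rule integrable_sign_step)
  show "coin_flips.expectation (sign_step \<beta> n) = 0" for n by (rule expectation_sign_step)
  show "integrable coin_flips (\<lambda>x. (sign_step \<beta> n x)\<^sup>2)" for n by (simp add: sign_step_squared)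
  show "\<not> edgeworth_expansion coin_flips (partial_sum (sign_step \<beta>)) s"
    if "real s > 1 / (1 - 2 * \<beta>)" for s
    using assms that by (intro sign_step_not_edgeworth_expansion) auto
  \<comment> \<open>The absolute value is constant on the whole space, which has mass 1, so the
    essential supremum is that constant.\<close>
  have norm: "Linf_norm coin_flips (sign_step \<beta> n) = ereal (dyadic_step \<beta> n)" for n
    unfolding Linf_norm_def abs_sign_step
    by (rule esssup_const) (simp add: coin_flips.emeasure_space_1 del: space_PiM)
  have "\<forall>\<^sub>F n in sequentially.
      ereal (1 * real n powr (- \<beta>)) \<le> Linf_norm coin_flips (sign_step \<beta> n) \<and>
      Linf_norm coin_flips (sign_step \<beta> n) \<le> ereal (2 * real n powr (- \<beta>))"
    using eventually_ge_at_top[of 1]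
    by eventually_elim (use assms dyadic_step_bounds in \<open>auto simp: norm\<close>)
  then show "\<exists>C1>0. \<exists>C2>0. \<forall>\<^sub>F n in sequentially.
      ereal (C1 * real n powr (- \<beta>)) \<le> Linf_norm coin_flips (sign_step \<beta> n) \<and>
      Linf_norm coin_flips (sign_step \<beta> n) \<le> ereal (C2 * real n powr (- \<beta>))"
    using zero_less_one zero_less_numeral by blast
  let ?V = "\<lambda>N. coin_flips.variance (partial_sum (sign_step \<beta>) N)"
  have "\<forall>\<^sub>F N in sequentially. 1 \<le> ?V N / real N powr (1 - 2 * \<beta>) \<and>
      ?V N / real N powr (1 - 2 * \<beta>) \<le> 4 / (1 - 2 * \<beta>)"
    using eventually_ge_at_top[of 1]
  proof eventually_elim
    case (elim N)
    then have "real N powr (1 - 2 * \<beta>) > 0" by simp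
    then show ?case
      unfolding partial_sum_sign_step(4)
      using sum_dyadic_step_squared_bounds[OF assms elim] by (simp add: pos_le_divide_eq pos_divide_le_eq)
  qed
  moreover have "4 / (1 - 2 * \<beta>) > 0" using assms by simp
  ultimately show "\<exists>c1>0. \<exists>c2>0. \<forall>\<^sub>F N in sequentially.
      c1 \<le> ?V N / real N powr (1 - 2 * \<beta>) \<and> ?V N / real N powr (1 - 2 * \<beta>) \<le> c2"
    using zero_less_one by blast
qed

end
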